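(* Let $a,z\in\mathbb{D}^\times$ with $a\neq z$. Then the Green's function $G_{\mathbb{D}}$ of the unit disk can be expressed as $$G_{\mathbb{D}}(a,z)=\ln\left|\frac{1-\overline{a}z}{a-z}\right|=\sum_{k=-\infty}^{\infty}\ln\left|\frac{(\log z+2\pi i k)+\overline{\log a}}{(\log z+2\pi i k)-\log a}\right|.$$
   Context: $\mathbb{D}=\{z\in\mathbb{C}:|z|<1\}$ and $\mathbb{D}^\times=\{z\in\mathbb{C}:0<|z|<1\}$. Here $\ln$ denotes the real logarithm of a positive real number, and $\log z$, $\log a$ denote any choice of complex logarithms of $z$ and $a$; the value of the sum does not depend on these choices. The Green's function $G_\Omega(a,z)$ of a domain $\Omega\subseteq\mathbb{C}$, with $a\in\Omega$, is the function of $z\in\Omega\setminus\{a\}$ satisfying: (i) $z\mapsto G_\Omega(a,z)$ is harmonic and positive on $\Omega\setminus\{a\}$; (ii) $G_\Omega(a,z)\to 0$ as $z$ tends to the boundary of $\Omega$, taken in the Riemann sphere; (iii) $z\mapsto G_\Omega(a,z)+\ln|a-z|$ extends to be continuous (and therefore harmonic) at $z=a$. *)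

theory Defs
  imports "HOL-Complex_Analysis.Complex_Analysis"
begin

text \<open>
  Harmonic means twice continuously differentiable with vanishing Laplacian, with
  \<open>\<complex>\<close> regarded as \<open>\<real>\<^sup>2\<close>.  The witnesses are the first and second partial derivatives of
  \<open>u\<close>; continuity of \<open>ux\<close> and \<open>uy\<close> follows from their differentiability.
\<close>

definition harmonic_on :: "(complex \<Rightarrow> real) \<Rightarrow> complex set \<Rightarrow> bool"
    (infixl \<open>harmonic'_on\<close> 50) where
  "u harmonic_on S \<longleftrightarrow> open S \<and>
     (\<exists>ux uy uxx uxy uyx uyy :: complex \<Rightarrow> real.
        continuous_on S uxx \<and> continuous_on S uxy \<and>
        continuous_on S uyx \<and> continuous_on S uyy \<and>
        (\<forall>z\<in>S.
           (u has_derivative (\<lambda>h. ux z * Re h + uy z * Im h)) (at z) \<and>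
           (ux has_derivative (\<lambda>h. uxx z * Re h + uxy z * Im h)) (at z) \<and>
           (uy has_derivative (\<lambda>h. uyx z * Re h + uyy z * Im h)) (at z) \<and>
           uxx z + uyy z = 0))"

text \<open>
  The boundary of \<open>\<Omega>\<close> in the Riemann sphere is \<open>frontier \<Omega>\<close>, together with \<open>\<infinity>\<close> if \<open>\<Omega>\<close> is
  unbounded.  No case distinction is needed for \<open>\<infinity>\<close>: if \<open>\<Omega>\<close> is bounded, the filter
  \<open>inf at_infinity (principal (\<Omega> - {a}))\<close> is \<open>bot\<close>.
\<close>

definition is_green_function :: "complex set \<Rightarrow> complex \<Rightarrow> (complex \<Rightarrow> real) \<Rightarrow> bool" where
  "is_green_function \<Omega> a g \<longleftrightarrow>
     open \<Omega> \<and> connected \<Omega> \<and> a \<in> \<Omega> \<and>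
     g harmonic_on (\<Omega> - {a}) \<and> (\<forall>z\<in>\<Omega> - {a}. g z > 0) \<and>
     (\<forall>w\<in>frontier \<Omega>. (g \<longlongrightarrow> 0) (at w within \<Omega> - {a})) \<and>
     (g \<longlongrightarrow> 0) (inf at_infinity (principal (\<Omega> - {a}))) \<and>
     (\<exists>h. isCont h a \<and> (\<forall>z\<in>\<Omega> - {a}. h z = g z + ln (cmod (a - z))))"

text \<open>
  The Green's function is only determined on \<open>\<Omega> - {a}\<close>; restricting to \<open>extensional\<close>
  functions makes the description unique.
\<close>

definition green_function :: "complex set \<Rightarrow> complex \<Rightarrow> complex \<Rightarrow> real" where
  "green_function \<Omega> a = (THE g. is_green_function \<Omega> a g \<and> g \<in> extensional (\<Omega> - {a}))"

end

theory Submission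
  imports Defs
begin

text \<open>
  The exponential map is the universal covering of the punctured disk by the left half-plane
  \<open>{w. Re w < 0}\<close>, and \<open>ln (cmod ((w + cnj b) / (w - b)))\<close> is the Green's function of the
  half-plane with pole \<open>b\<close>.  Filling in the puncture does not change the Green's function,
  because a single point is negligible for bounded harmonic functions.  So the sum over all
  preimages \<open>w = log_z + 2 \<pi> i k\<close> of \<open>z\<close>, with \<open>b = log_a\<close>, has to give the Green's function of
  the disk.  The proof makes both identities explicit.

  For the closed formula, the function \<open>ln (cmod ((1 - cnj a * z) / (a - z)))\<close> is the logarithm
  of the modulus of a zero-free holomorphic function away from \<open>a\<close>, hence harmonic, and it is
  positive in the disk and zero on the circle (\<open>is_green_function_disk\<close>).  Any two Green's
  functions \<open>g1\<close>, \<open>g2\<close> of a bounded domain coincide: \<open>g1 - (1 + e) * g2\<close> tends to \<open>-\<infinity>\<close> at the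
  pole and to \<open>0\<close> at the boundary, so by the maximum principle it is nonpositive, and \<open>e\<close> can be
  sent to \<open>0\<close> (\<open>green_function_le\<close>).  This also avoids a theorem on removable singularities.

  For the series, put \<open>u = (log_z + cnj log_a) / (2 \<pi> i)\<close> and \<open>v = (log_z - log_a) / (2 \<pi> i)\<close>.
  The symmetric partial sums are \<open>ln (cmod (\<Prod>k=-n..n. (u + k) / (v + k)))\<close>, and Euler's product
  for the sine shows that the products tend to \<open>sin (\<pi> u) / sin (\<pi> v)\<close>, whose modulus turns out to
  be that of \<open>(1 - cnj a * z) / (a - z)\<close>.  Every term of the series is nonnegative, so
  convergence of these particular partial sums is already unconditional summability
  (\<open>half_plane_sum\<close>).
\<close>

section \<open>The maximum principle\<close>

text \<open>
  At an interior maximum \<open>f' 0 = 0\<close>; if \<open>f'\<close> were increasing through \<open>0\<close>, then \<open>f\<close> would strictly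
  increase to the right of \<open>0\<close>.
\<close>

lemma no_local_max_if_second_deriv_pos:
  fixes f f' :: "real \<Rightarrow> real"
  assumes r: "0 < r" and df: "\<And>t. \<bar>t\<bar> < r \<Longrightarrow> (f has_real_derivative f' t) (at t)"
    and df': "(f' has_real_derivative c) (at 0)" and c: "0 < c"
    and max: "\<And>t. \<bar>t\<bar> < r \<Longrightarrow> f t \<le> f 0"
  shows False
proof -
  have f'0: "f' 0 = 0"
    using DERIV_local_max[OF df[of 0] r] r max by simp
  obtain d where d: "0 < d" "\<And>h. 0 < h \<Longrightarrow> h < d \<Longrightarrow> f' 0 < f' (0 + h)"
    using DERIV_pos_inc_right[OF df' c] by blast
  define t where "t = min d r / 2"
  have t: "0 < t" "t < d" "t < r" using d(1) r by (auto simp: t_def)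
  have "f 0 < f t"
  proof (rule DERIV_pos_imp_increasing_open[OF t(1)])
    fix x assume x: "0 < x" "x < t"
    show "\<exists>y. DERIV f x :> y \<and> 0 < y"
      using df[of x] d(2)[of x] f'0 x t by auto
  next
    show "continuous_on {0..t} f"
      using df t by (intro continuous_at_imp_continuous_on ballI DERIV_isCont) (auto intro!: df)
  qed
  with max[of t] t show False by simp
qed

lemma harmonic_on_add_scaled:
  assumes harm_u: "u harmonic_on S" and harm_v: "v harmonic_on S"
  shows "(\<lambda>z. u z + c * v z) harmonic_on S"
proof -
  from harm_u obtain ux uy uxx uxy uyx uyy where S: "open S" and
    cu: "continuous_on S uxx" "continuous_on S uxy" "continuous_on S uyx" "continuous_on S uyy" and
    u: "\<And>z. z \<in> S \<Longrightarrow> (u has_derivative (\<lambda>h. ux z * Re h + uy z * Im h)) (at z)"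
       "\<And>z. z \<in> S \<Longrightarrow> (ux has_derivative (\<lambda>h. uxx z * Re h + uxy z * Im h)) (at z)"
       "\<And>z. z \<in> S \<Longrightarrow> (uy has_derivative (\<lambda>h. uyx z * Re h + uyy z * Im h)) (at z)"
       "\<And>z. z \<in> S \<Longrightarrow> uxx z + uyy z = 0"
    unfolding harmonic_on_def by blast
  from harm_v obtain vx vy vxx vxy vyx vyy where
    cv: "continuous_on S vxx" "continuous_on S vxy" "continuous_on S vyx" "continuous_on S vyy" and
    v: "\<And>z. z \<in> S \<Longrightarrow> (v has_derivative (\<lambda>h. vx z * Re h + vy z * Im h)) (at z)"
       "\<And>z. z \<in> S \<Longrightarrow> (vx has_derivative (\<lambda>h. vxx z * Re h + vxy z * Im h)) (at z)"
       "\<And>z. z \<in> S \<Longrightarrow> (vy has_derivative (\<lambda>h. vyx z * Re h + vyy z * Im h)) (at z)"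
       "\<And>z. z \<in> S \<Longrightarrow> vxx z + vyy z = 0"
    unfolding harmonic_on_def by blast
  have comb: "((\<lambda>w. f w + c * g w) has_derivative
                 (\<lambda>h. (p + c * p') * Re h + (q + c * q') * Im h)) (at z)"
    if "(f has_derivative (\<lambda>h. p * Re h + q * Im h)) (at z)"
       "(g has_derivative (\<lambda>h. p' * Re h + q' * Im h)) (at z)"
    for f g :: "complex \<Rightarrow> real" and p p' q q' z
    by (rule has_derivative_eq_rhs[OF has_derivative_add[OF that(1) has_derivative_mult_right[OF that(2)]]])
       (rule ext, simp only: distrib_left distrib_right mult.assoc add.assoc add.left_commute)
  have lap: "(uxx z + c * vxx z) + (uyy z + c * vyy z) = 0" if "z \<in> S" for z
  proof -
    have "(uxx z + c * vxx z) + (uyy z + c * vyy z) = (uxx z + uyy z) + c * (vxx z + vyy z)"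
      by (simp add: algebra_simps)
    then show ?thesis using u(4) v(4) that by simp
  qed
  show ?thesis
    unfolding harmonic_on_def
    by (rule conjI[OF S], rule exI[of _ "\<lambda>z. ux z + c * vx z"], rule exI[of _ "\<lambda>z. uy z + c * vy z"],
        rule exI[of _ "\<lambda>z. uxx z + c * vxx z"], rule exI[of _ "\<lambda>z. uxy z + c * vxy z"],
        rule exI[of _ "\<lambda>z. uyx z + c * vyx z"], rule exI[of _ "\<lambda>z. uyy z + c * vyy z"])
       (auto intro!: continuous_intros cu cv comb u(1-3) v(1-3) lap)
qed

lemma harmonic_on_cong:
  assumes u: "u harmonic_on S" and eq: "\<And>z. z \<in> S \<Longrightarrow> u z = v z"
  shows "v harmonic_on S"
proof -
  from u obtain ux uy uxx uxy uyx uyy where S: "open S" and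
    c: "continuous_on S uxx" "continuous_on S uxy" "continuous_on S uyx" "continuous_on S uyy" and
    d: "\<And>z. z \<in> S \<Longrightarrow> (u has_derivative (\<lambda>h. ux z * Re h + uy z * Im h)) (at z)"
       "\<And>z. z \<in> S \<Longrightarrow> (ux has_derivative (\<lambda>h. uxx z * Re h + uxy z * Im h)) (at z)"
       "\<And>z. z \<in> S \<Longrightarrow> (uy has_derivative (\<lambda>h. uyx z * Re h + uyy z * Im h)) (at z)"
       "\<And>z. z \<in> S \<Longrightarrow> uxx z + uyy z = 0"
    unfolding harmonic_on_def by blast
  have dv: "(v has_derivative (\<lambda>h. ux z * Re h + uy z * Im h)) (at z)" if "z \<in> S" for z
    using d(1)[OF that] S that eq by (rule has_derivative_transform_within_open)
  show ?thesis
    unfolding harmonic_on_def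
    by (rule conjI[OF S], rule exI[of _ ux], rule exI[of _ uy], rule exI[of _ uxx],
        rule exI[of _ uxy], rule exI[of _ uyx], rule exI[of _ uyy])
       (use c d(2-4) dv in simp)
qed

lemma harmonic_on_imp_continuous_on: "u harmonic_on S \<Longrightarrow> continuous_on S u"
  unfolding harmonic_on_def
  by (meson continuous_at_imp_continuous_on has_derivative_continuous)

text \<open>
  The boundary condition says that the upper limit of \<open>u\<close> at each boundary point is at most \<open>0\<close>; it
  permits \<open>u\<close> to tend to \<open>-\<infinity>\<close>, which is what happens at the pole of a Green's function below.

  If \<open>u\<close> took a value \<open>m > 0\<close>, then \<open>v w = u w + \<delta> * (cmod w)\<^sup>2\<close> for a small \<open>\<delta> > 0\<close> would still attain
  its maximum inside \<open>U\<close>.  There both pure second derivatives of \<open>v\<close> are nonpositive, although their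
  sum, the Laplacian, is \<open>4 * \<delta>\<close>.
\<close>

lemma harmonic_maximum_principle:
  assumes harm: "u harmonic_on U" and bdd: "bounded U"
    and bdry: "\<And>w e. w \<in> frontier U \<Longrightarrow> 0 < e \<Longrightarrow> eventually (\<lambda>x. u x < e) (at w within U)"
    and p: "p \<in> U"
  shows "u p \<le> 0"
proof (rule ccontr)
  assume "\<not> u p \<le> 0"
  define m where "m = u p"
  have m: "0 < m" using \<open>\<not> u p \<le> 0\<close> by (simp add: m_def)
  obtain ux uy uxx uxy uyx uyy where U: "open U" and
    d: "\<And>z. z \<in> U \<Longrightarrow> (u has_derivative (\<lambda>h. ux z * Re h + uy z * Im h)) (at z)"
       "\<And>z. z \<in> U \<Longrightarrow> (ux has_derivative (\<lambda>h. uxx z * Re h + uxy z * Im h)) (at z)"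
       "\<And>z. z \<in> U \<Longrightarrow> (uy has_derivative (\<lambda>h. uyx z * Re h + uyy z * Im h)) (at z)"
       "\<And>z. z \<in> U \<Longrightarrow> uxx z + uyy z = 0"
    using harm unfolding harmonic_on_def by blast
  obtain R where R: "0 < R" "\<And>w. w \<in> U \<Longrightarrow> cmod w \<le> R"
    using bdd by (auto simp: bounded_pos)
  \<comment> \<open>On \<open>U\<close> the perturbation is at most \<open>m / 2\<close>, so a point where \<open>u < m / 2\<close> cannot beat \<open>p\<close>.\<close>
  define \<delta> where "\<delta> = m / (2 * R\<^sup>2)"
  have \<delta>: "0 < \<delta>" "\<delta> * R\<^sup>2 = m / 2" using m R(1) by (auto simp: \<delta>_def)
  define v where "v w = u w + \<delta> * (cmod w)\<^sup>2" for w
  define C where "C = {w \<in> U. m / 2 \<le> u w}"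
  have contu: "continuous_on U u" using harm by (rule harmonic_on_imp_continuous_on)
  \<comment> \<open>A limit point of \<open>C\<close> cannot lie on the frontier, where \<open>u\<close> is eventually below \<open>m / 2\<close>.\<close>
  have "closed C"
    unfolding closed_sequential_limits
  proof (intro allI impI, elim conjE)
    fix x l assume x: "\<forall>n. x n \<in> C" and l: "x \<longlonglongrightarrow> l"
    have xU: "x n \<in> U" "m / 2 \<le> u (x n)" for n using x by (auto simp: C_def)
    have lc: "l \<in> closure U" using xU(1) l closure_sequential by blast
    show "l \<in> C"
    proof (cases "l \<in> U")
      case True
      have "(\<lambda>n. u (x n)) \<longlonglongrightarrow> u l"
        using contu True xU(1) l
        by (intro continuous_on_tendsto_compose[OF contu l]) auto
      then have "m / 2 \<le> u l" using xU(2) by (intro LIMSEQ_le_const) auto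
      with True show ?thesis by (simp add: C_def)
    next
      case False
      then have "l \<in> frontier U" using lc U by (simp add: frontier_def interior_open)
      then have "eventually (\<lambda>y. u y < m / 2) (at l within U)"
        using bdry[of l "m / 2"] m by (metis half_gt_zero)
      moreover have "filterlim x (at l within U) sequentially"
        unfolding filterlim_at using l xU(1) False by (auto intro!: always_eventually)
      ultimately have "eventually (\<lambda>n. u (x n) < m / 2) sequentially"
        by (rule eventually_compose_filterlim)
      then obtain n where "u (x n) < m / 2" by (auto simp: eventually_sequentially)
      with xU(2)[of n] show ?thesis by simp
    qed
  qed
  moreover have "bounded C" using bdd by (rule bounded_subset) (auto simp: C_def)
  ultimately have "compact C" by (simp add: compact_eq_bounded_closed)
  moreover have pC: "p \<in> C" using p m by (simp add: C_def m_def)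
  moreover have "continuous_on C v" unfolding v_def
    by (intro continuous_intros continuous_on_subset[OF contu]) (auto simp: C_def)
  ultimately obtain q where q: "q \<in> C" "\<And>w. w \<in> C \<Longrightarrow> v w \<le> v q"
    using continuous_attains_sup[of C v] by blast
  have qU: "q \<in> U" using q(1) by (simp add: C_def)
  have vq: "m \<le> v q" using q(2)[OF pC] \<delta>(1) by (simp add: v_def m_def) (smt (verit) mult_nonneg_nonneg zero_le_power2)
  have vmax: "v w \<le> v q" if "w \<in> U" for w
  proof (cases "w \<in> C")
    case False
    then have "u w < m / 2" using that by (simp add: C_def)
    moreover have "\<delta> * (cmod w)\<^sup>2 \<le> \<delta> * R\<^sup>2"
      using R(2)[OF that] \<delta>(1) by (intro mult_left_mono power_mono) auto
    ultimately show ?thesis using vq \<delta>(2) by (simp add: v_def)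
  qed (use q in simp)
  obtain r where r: "0 < r" "ball q r \<subseteq> U" using U qU open_contains_ball by blast
  \<comment> \<open>The directions \<open>b = 1\<close> and \<open>b = \<i>\<close> give the second derivatives in \<open>x\<close> and in \<open>y\<close>.\<close>
  have *: "\<not> 0 < (if b = 1 then uxx q else uyy q) + 2 * \<delta>" if b: "b = 1 \<or> b = \<i>" for b
  proof
    assume pos: "0 < (if b = 1 then uxx q else uyy q) + 2 * \<delta>"
    have inU: "q + of_real t * b \<in> U" if "\<bar>t\<bar> < r" for t
      using r(2) that b by (auto simp: dist_norm norm_mult subset_iff)
    have line: "((\<lambda>t. q + of_real t * b) has_derivative (\<lambda>h. of_real h * b)) (at t)" for t :: real
      by (auto intro!: derivative_eq_intros)
    define f' where "f' t = (if b = 1 then ux (q + of_real t * b) + 2 * \<delta> * (Re q + t)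
                                      else uy (q + of_real t * b) + 2 * \<delta> * (Im q + t))" for t
    show False
    proof (rule no_local_max_if_second_deriv_pos[OF r(1) _ _ pos])
      fix t :: real assume t: "\<bar>t\<bar> < r"
      show "((\<lambda>t. v (q + of_real t * b)) has_real_derivative f' t) (at t)"
        using has_derivative_compose[OF line d(1)[OF inU[OF t]]] b
        unfolding v_def f'_def cmod_power2 has_field_derivative_def
        by (auto intro!: derivative_eq_intros simp: algebra_simps fun_eq_iff)
    next
      show "(f' has_real_derivative (if b = 1 then uxx q else uyy q) + 2 * \<delta>) (at 0)"
        using has_derivative_compose[OF line d(2)[OF inU[of 0]]]
          has_derivative_compose[OF line d(3)[OF inU[of 0]]] b r(1)
        unfolding f'_def has_field_derivative_def
        by (auto intro!: derivative_eq_intros simp: algebra_simps fun_eq_iff)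
    next
      fix t :: real assume t: "\<bar>t\<bar> < r"
      show "v (q + of_real t * b) \<le> v (q + of_real 0 * b)"
        using vmax[OF inU[OF t]] by simp
    qed
  qed
  from *[of 1] *[of \<i>] d(4)[OF qU] \<delta>(1) show False by simp
qed

section \<open>Uniqueness of the Green's function\<close>

text \<open>
  The comparison is strict at the pole when \<open>g2\<close> is enlarged to \<open>(1 + e) * g2\<close>: the logarithmic
  singularities then leave \<open>e * ln (cmod (a - x))\<close>, which tends to \<open>-\<infinity>\<close>, so the maximum principle
  applies on \<open>\<Omega> - {a}\<close> with \<open>a\<close> as an extra boundary point.
\<close>

lemma green_function_le:
  assumes bdd: "bounded \<Omega>" and g1: "is_green_function \<Omega> a g1" and g2: "is_green_function \<Omega> a g2"
    and p: "p \<in> \<Omega> - {a}"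
  shows "g1 p \<le> g2 p"
proof -
  have *: "g1 p + (- 1 - e) * g2 p \<le> 0" if e: "0 < e" for e
  proof (rule harmonic_maximum_principle[OF _ _ _ p])
    show "(\<lambda>z. g1 z + (- 1 - e) * g2 z) harmonic_on (\<Omega> - {a})"
      using g1 g2 by (intro harmonic_on_add_scaled) (auto simp: is_green_function_def)
    show "bounded (\<Omega> - {a})" using bdd by (rule bounded_subset) auto
    fix w e' :: _ assume w: "w \<in> frontier (\<Omega> - {a})" and e': "(0::real) < e'"
    have "w \<in> frontier \<Omega> \<or> w = a"
      using w g1 unfolding is_green_function_def frontier_def
      by (auto simp: interior_open open_delete dest: subsetD[OF closure_mono, rotated])
    then show "\<forall>\<^sub>F x in at w within \<Omega> - {a}. g1 x + (- 1 - e) * g2 x < e'"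
    proof
      assume "w \<in> frontier \<Omega>"
      then have "((\<lambda>x. g1 x + (- 1 - e) * g2 x) \<longlongrightarrow> 0 + (- 1 - e) * 0) (at w within \<Omega> - {a})"
        using g1 g2 unfolding is_green_function_def by (intro tendsto_intros) auto
      then show ?thesis using e' by (intro order_tendstoD(2)) auto
    next
      assume w: "w = a"
      obtain h1 where h1: "isCont h1 a" "\<And>z. z \<in> \<Omega> - {a} \<Longrightarrow> h1 z = g1 z + ln (cmod (a - z))"
        using g1 unfolding is_green_function_def by blast
      obtain h2 where h2: "isCont h2 a" "\<And>z. z \<in> \<Omega> - {a} \<Longrightarrow> h2 z = g2 z + ln (cmod (a - z))"
        using g2 unfolding is_green_function_def by blast
      define h where "h z = h1 z + (- 1 - e) * h2 z" for z
      have "(h \<longlongrightarrow> h a) (at a)" unfolding h_def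
        using h1(1) h2(1) by (intro tendsto_intros) (auto simp: isCont_def)
      then have 1: "\<forall>\<^sub>F x in at a. h x < h a + 1" by (rule order_tendstoD) simp
      have "filterlim (\<lambda>z. cmod (a - z)) (at_right 0) (at a)"
        unfolding filterlim_at by (auto intro!: tendsto_eq_intros simp: eventually_at_filter)
      then have "filterlim (\<lambda>z. ln (cmod (a - z))) at_bot (at a)"
        by (rule filterlim_compose[OF ln_at_0])
      then have 2: "\<forall>\<^sub>F x in at a. ln (cmod (a - x)) \<le> - (h a + 1) / e"
        unfolding filterlim_at_bot by blast
      have "\<forall>\<^sub>F x in at a within \<Omega> - {a}. h x < h a + 1 \<and> ln (cmod (a - x)) \<le> - (h a + 1) / e \<and> x \<in> \<Omega> - {a}"
        using eventually_conj[OF 1 2] by (auto simp: eventually_at_filter elim: eventually_mono)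
      then show ?thesis unfolding w
      proof (rule eventually_mono, elim conjE)
        fix x assume x: "h x < h a + 1" "ln (cmod (a - x)) \<le> - (h a + 1) / e" "x \<in> \<Omega> - {a}"
        have "e * ln (cmod (a - x)) \<le> - (h a + 1)" using x(2) e by (simp add: field_simps)
        moreover have "g1 x + (- 1 - e) * g2 x = h x + e * ln (cmod (a - x))"
          using h1(2)[OF x(3)] h2(2)[OF x(3)] by (simp add: h_def algebra_simps)
        ultimately show "g1 x + (- 1 - e) * g2 x < e'" using x(1) e' by simp
      qed
    qed
  qed
  have g2p: "0 < g2 p" using g2 p by (simp add: is_green_function_def)
  \<comment> \<open>The bound \<open>g1 p \<le> (1 + e) * g2 p\<close> for all \<open>e > 0\<close>; rescale \<open>e\<close> by \<open>g2 p\<close>.\<close>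
  show ?thesis
  proof (rule field_le_epsilon)
    fix e :: real assume "0 < e"
    then show "g1 p \<le> g2 p + e"
      using *[of "e / g2 p"] g2p by (simp add: left_diff_distrib)
  qed
qed

text \<open>
  Reduces evaluating the definite description to exhibiting one Green's function, which may take
  arbitrary values outside \<open>\<Omega> - {a}\<close>.
\<close>

lemma green_function_eqI:
  assumes bdd: "bounded \<Omega>" and g: "is_green_function \<Omega> a g" and p: "p \<in> \<Omega> - {a}"
  shows "green_function \<Omega> a p = g p"
proof -
  let ?g = "restrict g (\<Omega> - {a})"
  have g': "is_green_function \<Omega> a ?g"
  proof -
    have lim: "(?g \<longlongrightarrow> 0) F" if "(g \<longlongrightarrow> 0) F" "\<forall>\<^sub>F x in F. x \<in> \<Omega> - {a}" for F
      using that(1) by (rule Lim_transform_eventually) (rule eventually_mono[OF that(2)], simp)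
    have "?g harmonic_on (\<Omega> - {a})"
      by (rule harmonic_on_cong[of g]) (use g in \<open>auto simp: is_green_function_def\<close>)
    with g show ?thesis unfolding is_green_function_def
      by (auto intro!: lim simp: eventually_at_filter eventually_inf_principal)
  qed
  have "green_function \<Omega> a = ?g"
    unfolding green_function_def
  proof (rule the_equality, intro conjI g')
    fix f assume f: "is_green_function \<Omega> a f \<and> f \<in> extensional (\<Omega> - {a})"
    show "f = ?g"
    proof (rule extensionalityI[of _ "\<Omega> - {a}"])
      fix x assume "x \<in> \<Omega> - {a}"
      then show "f x = ?g x"
        using green_function_le[OF bdd _ g'] green_function_le[OF bdd g'] f by (meson antisym)
    qed (use f in auto)
  qed auto
  with p show ?thesis by simp
qed

section \<open>The Green's function of the disk\<close>

text \<open>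
  Locally \<open>ln (cmod (f z))\<close> is the real part of a holomorphic logarithm of \<open>f\<close>.  The logarithm itself
  need not exist on \<open>S\<close>, but its derivative \<open>q = f' / f\<close> does, and by the Cauchy-Riemann equations
  all partial derivatives can be read off from \<open>q\<close> and \<open>q'\<close>.
\<close>

lemma harmonic_on_ln_norm:
  assumes S: "open S" and f: "f holomorphic_on S" and nz: "\<And>z. z \<in> S \<Longrightarrow> f z \<noteq> 0"
  shows "(\<lambda>z. ln (cmod (f z))) harmonic_on S"
proof -
  define q where "q z = deriv f z / f z" for z
  have q: "q holomorphic_on S" unfolding q_def
    using S f nz by (intro holomorphic_intros) auto
  have dq: "(q has_field_derivative deriv q z) (at z)" if "z \<in> S" for z
    using q S that by (rule holomorphic_derivI)
  have cq: "continuous_on S (deriv q)"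
    using q S by (intro holomorphic_on_imp_continuous_on holomorphic_deriv)
  have 1: "((\<lambda>z. ln (cmod (f z))) has_derivative (\<lambda>h. Re (q z) * Re h + - Im (q z) * Im h)) (at z)"
    if z: "z \<in> S" for z
  proof -
    have df: "(f has_derivative (\<lambda>h. deriv f z * h)) (at z)"
      using holomorphic_derivI[OF f S z] by (simp add: has_field_derivative_def)
    have "((\<lambda>z. ln (cmod (f z))) has_derivative
            (\<lambda>h. (deriv f z * h) \<bullet> sgn (f z) / cmod (f z))) (at z)"
      using nz[OF z] has_derivative_compose[OF df has_derivative_norm[OF nz[OF z]]]
      by (auto intro!: derivative_eq_intros simp: divide_simps)
    moreover have "x \<bullet> sgn y / cmod y = Re (x / y)" for x y :: complex
    proof -
      have "x \<bullet> sgn y / cmod y = x \<bullet> y / (cmod y)\<^sup>2"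
        by (simp add: sgn_div_norm power2_eq_square divide_inverse)
      then show ?thesis by (simp add: inner_complex_def Re_divide cmod_power2)
    qed
    then have "(deriv f z * h) \<bullet> sgn (f z) / cmod (f z) = Re (q z) * Re h + - Im (q z) * Im h" for h
      using nz[OF z] by (simp add: q_def times_divide_eq_left[symmetric] del: times_divide_eq_left)
    ultimately show ?thesis by simp
  qed
  have 2: "((\<lambda>z. Re (q z)) has_derivative (\<lambda>h. Re (deriv q z) * Re h + - Im (deriv q z) * Im h)) (at z)"
    and 3: "((\<lambda>z. - Im (q z)) has_derivative (\<lambda>h. - Im (deriv q z) * Re h + - Re (deriv q z) * Im h)) (at z)"
    if z: "z \<in> S" for z
    using dq[OF z] unfolding has_field_derivative_def
    by (auto intro!: derivative_eq_intros)
  show ?thesis unfolding harmonic_on_def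
    by (rule conjI[OF S], rule exI[of _ "\<lambda>z. Re (q z)"], rule exI[of _ "\<lambda>z. - Im (q z)"],
        rule exI[of _ "\<lambda>z. Re (deriv q z)"], rule exI[of _ "\<lambda>z. - Im (deriv q z)"],
        rule exI[of _ "\<lambda>z. - Im (deriv q z)"], rule exI[of _ "\<lambda>z. - Re (deriv q z)"])
       (auto intro!: continuous_intros cq 1[simplified] 2[simplified] 3[simplified])
qed

text \<open>
  The source of both the sign inside the disk and the vanishing on the circle.
\<close>

lemma norm_blaschke_identity:
  "(cmod (1 - cnj a * z))\<^sup>2 - (cmod (a - z))\<^sup>2 = (1 - (cmod a)\<^sup>2) * (1 - (cmod z)\<^sup>2)"
  unfolding cmod_power2 by (simp add: algebra_simps power2_eq_square)

lemma one_minus_cnj_mult_nonzero: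
  assumes "cmod a < 1" "cmod z \<le> 1"
  shows "1 - cnj a * z \<noteq> 0"
proof
  assume "1 - cnj a * z = 0"
  then have "cmod (cnj a * z) = 1" by (metis eq_iff_diff_eq_0 norm_one)
  with assms show False
    by (smt (verit) complex_mod_cnj mult_left_le norm_ge_zero norm_mult)
qed

lemma is_green_function_disk:
  assumes a: "cmod a < 1"
  shows "is_green_function (ball 0 1) a (\<lambda>z. ln (cmod ((1 - cnj a * z) / (a - z))))"
    (is "is_green_function _ _ ?g")
  unfolding is_green_function_def
proof (intro conjI ballI)
  note nz = one_minus_cnj_mult_nonzero[OF a]
  show "open (ball 0 1 :: complex set)" "connected (ball 0 1 :: complex set)" "a \<in> ball 0 1"
    using a by auto
  show "?g harmonic_on (ball 0 1 - {a})"
  proof (rule harmonic_on_ln_norm)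
    show "(\<lambda>z. (1 - cnj a * z) / (a - z)) holomorphic_on ball 0 1 - {a}"
      by (intro holomorphic_intros) auto
  qed (use nz in auto)
  show "0 < ?g z" if "z \<in> ball 0 1 - {a}" for z
  proof -
    have z: "cmod z < 1" "a \<noteq> z" using that by auto
    have "0 < (1 - (cmod a)\<^sup>2) * (1 - (cmod z)\<^sup>2)"
      using a z by (intro mult_pos_pos) (simp_all add: abs_square_less_1)
    then have "(cmod (a - z))\<^sup>2 < (cmod (1 - cnj a * z))\<^sup>2"
      using norm_blaschke_identity[of a z] by simp
    then have "cmod (a - z) < cmod (1 - cnj a * z)"
      by (rule power2_less_imp_less) simp
    then have "1 < cmod ((1 - cnj a * z) / (a - z))" using z by (simp add: norm_divide)
    then show ?thesis by (rule ln_gt_zero)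
  qed
  show "(?g \<longlongrightarrow> 0) (at w within ball 0 1 - {a})" if "w \<in> frontier (ball 0 1)" for w
  proof -
    have w: "cmod w = 1" using that by simp
    then have aw: "a - w \<noteq> 0" using a by auto
    have "cmod (1 - cnj a * w) = cmod (a - w)"
      using norm_blaschke_identity[of a w] w by (simp add: power2_eq_iff_nonneg)
    then have "?g w = 0" using aw by (simp add: norm_divide)
    moreover have "(?g \<longlongrightarrow> ?g w) (at w within ball 0 1 - {a})"
      using aw nz[of w] w by (intro tendsto_intros) auto
    ultimately show ?thesis by simp
  qed
  \<comment> \<open>The disk is bounded, so there is no boundary at infinity.\<close>
  have "inf at_infinity (principal (ball 0 1 - {a})) = (bot :: complex filter)"
  proof -
    have "\<forall>\<^sub>F x in at_infinity. x \<notin> ball 0 1 - {a}"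
      unfolding eventually_at_infinity by (intro exI[of _ 1]) auto
    then show ?thesis unfolding trivial_limit_def eventually_inf_principal by simp
  qed
  then show "(?g \<longlongrightarrow> 0) (inf at_infinity (principal (ball 0 1 - {a})))" by simp
  show "\<exists>h. isCont h a \<and> (\<forall>z\<in>ball 0 1 - {a}. h z = ?g z + ln (cmod (a - z)))"
  proof (intro exI[of _ "\<lambda>z. ln (cmod (1 - cnj a * z))"] conjI ballI)
    show "isCont (\<lambda>z. ln (cmod (1 - cnj a * z))) a"
      using nz[of a] a by (intro continuous_intros) auto
    fix z assume "z \<in> ball 0 1 - {a}"
    then show "ln (cmod (1 - cnj a * z)) = ?g z + ln (cmod (a - z))"
      using nz[of z] by (auto simp: norm_divide ln_div)
  qed
qed

section \<open>The series over the preimages\<close>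

text \<open>
  Each finite set of integers lies in a symmetric interval, so for nonnegative terms \<open>L\<close> bounds all
  finite sums; the sum therefore exists, and the symmetric intervals compute it.
\<close>

lemma has_sum_int_symmetric_limit:
  fixes f :: "int \<Rightarrow> real"
  assumes nonneg: "\<And>k. 0 \<le> f k"
    and lim: "(\<lambda>n. \<Sum>k = - int n..int n. f k) \<longlonglongrightarrow> L"
  shows "(f has_sum L) UNIV"
proof -
  have sub: "\<exists>N. \<forall>n\<ge>N. F \<subseteq> {- int n..int n}" if F: "finite F" for F
  proof (intro exI allI impI subsetI)
    fix n k assume n: "nat (Max ((\<lambda>k. \<bar>k\<bar>) ` F)) \<le> n" and k: "k \<in> F"
    have "\<bar>k\<bar> \<le> Max ((\<lambda>k. \<bar>k\<bar>) ` F)" using F k by (intro Max_ge) auto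
    with n show "k \<in> {- int n..int n}" by auto
  qed
  have "sum f F \<le> L" if F: "finite F" for F
  proof -
    obtain N where "\<forall>n\<ge>N. F \<subseteq> {- int n..int n}" using sub[OF F] by blast
    then show ?thesis
      by (intro LIMSEQ_le_const[OF lim]) (auto intro!: exI[of _ N] sum_mono2 nonneg)
  qed
  then have "f summable_on UNIV"
    by (intro nonneg_bdd_above_summable_on bdd_aboveI[of _ L]) (auto intro: nonneg)
  then obtain S where S: "(f has_sum S) UNIV" by (auto simp: summable_on_def)
  have "filterlim (\<lambda>n. {- int n..int n}) (finite_subsets_at_top UNIV) sequentially"
    unfolding filterlim_finite_subsets_at_top eventually_sequentially using sub by auto
  then have "(\<lambda>n. \<Sum>k = - int n..int n. f k) \<longlonglongrightarrow> S"
    using S unfolding has_sum_def by (rule filterlim_compose[rotated])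
  with lim have "S = L" by (rule LIMSEQ_unique[rotated])
  with S show ?thesis by simp
qed

lemma prod_int_symmetric:
  fixes w :: complex
  shows "(\<Prod>k = - int n..int n. w + of_int k) = w * (\<Prod>k=1..n. w\<^sup>2 - (of_nat k)\<^sup>2)"
proof (induction n)
  case (Suc n)
  have "{- int (Suc n)..int (Suc n)} = insert (- int (Suc n)) (insert (int (Suc n)) {- int n..int n})"
    by auto
  then show ?case
    using Suc by (simp add: algebra_simps power2_eq_square)
qed simp

text \<open>
  The factors \<open>1 - w\<^sup>2 / k\<^sup>2\<close> of Euler's product differ from \<open>w\<^sup>2 - k\<^sup>2\<close> by normalising constants, which
  cancel in the quotient.
\<close>

lemma prod_ratio_tendsto_sin_ratio:
  fixes u v :: complex
  assumes "sin (of_real pi * v) \<noteq> 0"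
  shows "(\<lambda>n. \<Prod>k = - int n..int n. (u + of_int k) / (v + of_int k))
           \<longlonglongrightarrow> sin (of_real pi * u) / sin (of_real pi * v)"
proof -
  have eq: "(\<Prod>k = - int n..int n. (u + of_int k) / (v + of_int k)) =
        (of_real pi * u * (\<Prod>k=1..n. 1 - u\<^sup>2 / (of_nat k)\<^sup>2)) /
        (of_real pi * v * (\<Prod>k=1..n. 1 - v\<^sup>2 / (of_nat k)\<^sup>2))" for n
  proof -
    have *: "(\<Prod>k=1..n. 1 - w\<^sup>2 / (of_nat k)\<^sup>2) =
            (\<Prod>k=1..n. w\<^sup>2 - (of_nat k)\<^sup>2) / (\<Prod>k=1..n. - (of_nat k)\<^sup>2)" for w :: complex
      unfolding prod_dividef[symmetric] by (intro prod.cong refl) (simp add: field_simps)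
    have "(\<Prod>k=1..n. - (of_nat k)\<^sup>2 :: complex) \<noteq> 0" by simp
    then show ?thesis unfolding prod_dividef prod_int_symmetric * by simp
  qed
  show ?thesis unfolding eq
    by (intro tendsto_divide sin_product_formula_complex assms)
qed

lemma norm_sin_eq_norm_exp:
  fixes w :: complex
  shows "cmod (sin (of_real pi * (w / (2 * of_real pi * \<i>)))) = cmod (exp w - 1) / (2 * exp (Re w / 2))"
proof -
  have "of_real pi * (w / (2 * of_real pi * \<i>)) = - (\<i> * (w / 2))"
    by (simp add: field_simps)
  then have "sin (of_real pi * (w / (2 * of_real pi * \<i>))) = (exp (w / 2) - exp (- (w / 2))) / (2 * \<i>)"
    by (simp add: sin_exp_eq)
  also have "exp (w / 2) - exp (- (w / 2)) = (exp w - 1) / exp (w / 2)"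
    by (simp add: exp_minus field_simps flip: exp_add)
  finally show ?thesis by (simp add: norm_divide norm_mult)
qed

text \<open>
  The Green's function of the left half-plane, summed over the orbit of \<open>s\<close> under the deck
  transformations \<open>w \<mapsto> w + 2 \<pi> i\<close> of the exponential.  Each term is nonnegative because a point of
  the left half-plane is closer to \<open>b\<close> than to the reflection \<open>- cnj b\<close> of \<open>b\<close> in the imaginary axis.
\<close>

lemma half_plane_sum:
  fixes s b :: complex
  assumes s: "Re s < 0" and b: "Re b < 0" and ne: "exp s \<noteq> exp b"
  shows "((\<lambda>k::int. ln (cmod ((s + 2 * of_real pi * \<i> * of_int k + cnj b) /
                              (s + 2 * of_real pi * \<i> * of_int k - b))))
            has_sum ln (cmod ((1 - cnj (exp b) * exp s) / (exp b - exp s)))) UNIV"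
    (is "(?f has_sum ?L) UNIV")
proof (rule has_sum_int_symmetric_limit)
  define c :: complex where "c = 2 * of_real pi * \<i>"
  have c: "c \<noteq> 0" by (simp add: c_def)
  have den: "s + c * of_int k - b \<noteq> 0" for k
  proof
    assume "s + c * of_int k - b = 0"
    then have "s = b + of_real (of_int (2 * - k) * pi) * \<i>"
      by (simp add: c_def algebra_simps add_eq_0_iff)
    then have "exp s = exp b" unfolding exp_eq by blast
    with ne show False by simp
  qed
  have num: "s + c * of_int k + cnj b \<noteq> 0" for k
  proof -
    have "Re (s + c * of_int k + cnj b) < 0" using s b by (simp add: c_def)
    then show ?thesis by (metis less_irrefl zero_complex.sel(1))
  qed
  show "0 \<le> ?f k" for k
  proof -
    have "(cmod (s + c * of_int k + cnj b))\<^sup>2 - (cmod (s + c * of_int k - b))\<^sup>2 = 4 * Re s * Re b"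
      unfolding cmod_power2 c_def by (simp add: algebra_simps power2_eq_square)
    moreover have "0 < Re s * Re b" using s b by (simp add: mult_neg_neg)
    ultimately have "(cmod (s + c * of_int k - b))\<^sup>2 \<le> (cmod (s + c * of_int k + cnj b))\<^sup>2" by argo
    then have "cmod (s + c * of_int k - b) \<le> cmod (s + c * of_int k + cnj b)"
      by (rule power2_le_imp_le) simp
    then show ?thesis using den[of k] unfolding c_def by (simp add: norm_divide)
  qed
  define u where "u = (s + cnj b) / c"
  define v where "v = (s - b) / c"
  have nu: "cmod (sin (of_real pi * u)) = cmod (exp (s + cnj b) - 1) / (2 * exp (Re (s + cnj b) / 2))"
    unfolding u_def c_def by (rule norm_sin_eq_norm_exp)
  have nv: "cmod (sin (of_real pi * v)) = cmod (exp (s - b) - 1) / (2 * exp (Re (s - b) / 2))"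
    unfolding v_def c_def by (rule norm_sin_eq_norm_exp)
  have v0: "sin (of_real pi * v) \<noteq> 0"
    using nv ne by (auto simp: exp_diff)
  have u0: "sin (of_real pi * u) \<noteq> 0"
  proof -
    have "cmod (exp (s + cnj b)) < 1" using s b by simp
    then have "exp (s + cnj b) \<noteq> 1" by (metis less_irrefl norm_one)
    then show ?thesis using nu by auto
  qed
  \<comment> \<open>Up to the factor \<open>exp (Re b)\<close> from \<open>exp b - exp s\<close>, the numerators match; the exponential factors
     of \<open>norm_sin_eq_norm_exp\<close> cancel it.\<close>
  have val: "cmod (sin (of_real pi * u) / sin (of_real pi * v)) =
             cmod ((1 - cnj (exp b) * exp s) / (exp b - exp s))"
  proof -
    have "exp (s - b) - 1 = (exp s - exp b) / exp b"
      by (simp add: exp_diff field_simps)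
    then have m1: "cmod (exp (s - b) - 1) = cmod (exp b - exp s) / exp (Re b)"
      by (simp only: norm_divide norm_exp_eq_Re norm_minus_commute)
    have m2: "cmod (exp (s + cnj b) - 1) = cmod (1 - cnj (exp b) * exp s)"
      by (simp add: exp_add exp_cnj norm_minus_commute mult.commute)
    have m3: "exp (Re b) * exp (Re (s - b) / 2) = exp (Re (s + cnj b) / 2)"
      by (simp add: field_simps flip: exp_add)
    show ?thesis unfolding norm_divide nu nv m1 m2 m3[symmetric] by simp
  qed
  have "(\<Sum>k = - int n..int n. ?f k) = ln (cmod (\<Prod>k = - int n..int n. (u + of_int k) / (v + of_int k)))" for n
  proof -
    have f: "?f k = ln (cmod ((u + of_int k) / (v + of_int k)))"
      and pos: "0 < cmod ((u + of_int k) / (v + of_int k))" for k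
    proof -
      have e: "(s + c * of_int k + cnj b) = c * (u + of_int k)" "(s + c * of_int k - b) = c * (v + of_int k)"
        using c by (simp_all add: u_def v_def field_simps)
      show "?f k = ln (cmod ((u + of_int k) / (v + of_int k)))"
        using c e unfolding c_def[symmetric] by simp
      show "0 < cmod ((u + of_int k) / (v + of_int k))"
        using num[of k] den[of k] unfolding e by simp
    qed
    show ?thesis unfolding f prod_norm[symmetric] by (rule ln_prod[symmetric]) (use pos in auto)
  qed
  moreover have "(\<lambda>n. ln (cmod (\<Prod>k = - int n..int n. (u + of_int k) / (v + of_int k)))) \<longlonglongrightarrow> ?L"
    unfolding val[symmetric] using u0 v0
    by (intro tendsto_ln tendsto_norm prod_ratio_tendsto_sin_ratio) auto
  ultimately show "(\<lambda>n. \<Sum>k = - int n..int n. ?f k) \<longlonglongrightarrow> ?L" by simp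
qed

theorem theorem3:
  fixes a z log_a log_z :: complex
  assumes "0 < cmod a" "cmod a < 1"
    and "0 < cmod z" "cmod z < 1"
    and "a \<noteq> z"
    and "exp log_a = a" and "exp log_z = z"
  shows "green_function (ball 0 1) a z = ln (cmod ((1 - cnj a * z) / (a - z))) \<and>
         ((\<lambda>k :: int. ln (cmod ((log_z + 2 * of_real pi * \<i> * of_int k + cnj log_a) /
                                (log_z + 2 * of_real pi * \<i> * of_int k - log_a))))
            has_sum ln (cmod ((1 - cnj a * z) / (a - z)))) UNIV"
proof
  show "green_function (ball 0 1) a z = ln (cmod ((1 - cnj a * z) / (a - z)))"
    using assms by (intro green_function_eqI is_green_function_disk) auto
  have "Re log_z < 0" "Re log_a < 0" "exp log_z \<noteq> exp log_a"
    using assms norm_exp_eq_Re[of log_z] norm_exp_eq_Re[of log_a] by auto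
  then show "((\<lambda>k :: int. ln (cmod ((log_z + 2 * of_real pi * \<i> * of_int k + cnj log_a) /
                                (log_z + 2 * of_real pi * \<i> * of_int k - log_a))))
            has_sum ln (cmod ((1 - cnj a * z) / (a - z)))) UNIV"
    using half_plane_sum[of log_z log_a] assms(6,7) by simp
qed

end
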